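(* Let $G$ be a finite connected graph and let $V_1,\ldots,V_t$ be the orbits under the natural action of the automorphism group $\mathrm{Aut}(G)$ on $V(G)$. If $\{F_1,\ldots,F_k\}$ is a partition of $E(G)$ that is coarser than the $\Theta^*$-partition of $E(G)$, then $$\widehat{W}(G) = |V(G)| \sum_{i=1}^t \frac{1}{|V_i|} \sum_{j=1}^k W(G/F_j, w_{ij}),$$ where $w_{ij}(C) = |V_i \cap C|$ (the number of vertices of the connected component $C$ that lie in $V_i$) for any $i \in \{1,\ldots,t\}$, $j \in \{1,\ldots,k\}$, and $C \in V(G/F_j)$.
   Context: Graphs are finite, simple and undirected. For a connected graph $G$, $d_G(x,y)$ is the length of a shortest path between $x$ and $y$. The natural action of $\mathrm{Aut}(G)$ on $V(G)$ is $(\alpha,u)\mapsto \alpha(u)$. The Graovac-Pisanski index of $G$ is $$\widehat{W}(G) = \frac{|V(G)|}{2\,|\mathrm{Aut}(G)|} \sum_{u \in V(G)} \sum_{\alpha \in \mathrm{Aut}(G)} d_G(u,\alpha(u)).$$ For a connected graph $H$ and a nonnegative real weight function $w$ on $V(H)$, the vertex-weighted Wiener index is $$W(H,w) = \frac12 \sum_{u\in V(H)}\sum_{v\in V(H)} w(u)\,w(v)\,d_H(u,v).$$ Two edges $e_1=u_1v_1$ and $e_2=u_2v_2$ of $G$ are in the Djoković-Winkler relation $\Theta$ if $d_G(u_1,u_2)+d_G(v_1,v_2)\neq d_G(u_1,v_2)+d_G(v_1,u_2)$. This relation is reflexive and symmetric; $\Theta^*$ denotes its transitive closure, an equivalence relation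 on $E(G)$. The $\Theta^*$-partition of $E(G)$ is the partition into the equivalence classes of $\Theta^*$ (the $\Theta^*$-classes). A partition $\{F_1,\ldots,F_k\}$ of $E(G)$ is coarser than the $\Theta^*$-partition if each $F_i$ is a union of one or more $\Theta^*$-classes. For $F\subseteq E(G)$, the quotient graph $G/F$ is the graph whose vertices are the connected components of $G-F$ (the graph obtained from $G$ by deleting the edges in $F$ and keeping all vertices), where two distinct components $C_1,C_2$ are adjacent in $G/F$ if some vertex of $C_1$ is adjacent in $G$ to some vertex of $C_2$. *)

theory Defs
  imports Complex_Main "HOL-Algebra.Group_Action" "HOL-Library.Disjoint_Sets"
begin

record 'a ugraph =
  verts :: "'a set"
  edges :: "'a set set"

definition finite_simple_graph :: "'a ugraph \<Rightarrow> bool" where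
  "finite_simple_graph G \<longleftrightarrow>
     finite (verts G) \<and> (\<forall>e \<in> edges G. e \<subseteq> verts G \<and> card e = 2)"

text \<open>A path is given by its list of vertices; its length is one less than the length of the list.\<close>

definition path :: "'a ugraph \<Rightarrow> 'a \<Rightarrow> 'a list \<Rightarrow> 'a \<Rightarrow> bool" where
  "path G x p y \<longleftrightarrow>
     p \<noteq> [] \<and> hd p = x \<and> last p = y \<and> set p \<subseteq> verts G \<and> distinct p \<and>
     successively (\<lambda>u v. {u, v} \<in> edges G) p"

text \<open>The graph without vertices also counts as connected here.\<close>

definition connected_graph :: "'a ugraph \<Rightarrow> bool" where
  "connected_graph G \<longleftrightarrow> (\<forall>x \<in> verts G. \<forall>y \<in> verts G. \<exists>p. path G x p y)"

text \<open>Meaningful only if some path joins the two vertices.\<close>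

definition gdist :: "'a ugraph \<Rightarrow> 'a \<Rightarrow> 'a \<Rightarrow> nat" where
  "gdist G x y = (LEAST n. \<exists>p. path G x p y \<and> length p = Suc n)"

text \<open>
  Automorphisms are extensional functions on the vertex set, as in \<^const>\<open>Bij\<close>, so that each
  automorphism is represented exactly once.
\<close>

definition aut_group :: "'a ugraph \<Rightarrow> ('a \<Rightarrow> 'a) monoid" where
  "aut_group G = (BijGroup (verts G))
     \<lparr>carrier := {\<alpha> \<in> Bij (verts G).
        \<forall>u \<in> verts G. \<forall>v \<in> verts G. {\<alpha> u, \<alpha> v} \<in> edges G \<longleftrightarrow> {u, v} \<in> edges G}\<rparr>"

definition vertex_orbits :: "'a ugraph \<Rightarrow> 'a set set" where
  "vertex_orbits G = orbits (aut_group G) (verts G) (\<lambda>\<alpha> u. \<alpha> u)"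

definition graovac_pisanski :: "'a ugraph \<Rightarrow> real" where
  "graovac_pisanski G =
     real (card (verts G)) / (2 * real (card (carrier (aut_group G)))) *
     (\<Sum>u \<in> verts G. \<Sum>\<alpha> \<in> carrier (aut_group G). real (gdist G u (\<alpha> u)))"

definition weighted_wiener :: "'a ugraph \<Rightarrow> ('a \<Rightarrow> real) \<Rightarrow> real" where
  "weighted_wiener H w =
     1 / 2 * (\<Sum>u \<in> verts H. \<Sum>v \<in> verts H. w u * w v * real (gdist H u v))"

text \<open>
  The defining inequality is invariant under exchanging the ends of either edge, so it does not
  matter which names the ends receive.
\<close>

definition djokovic_winkler :: "'a ugraph \<Rightarrow> 'a set rel" where
  "djokovic_winkler G =
     {(e1, e2). e1 \<in> edges G \<and> e2 \<in> edges G \<and>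
        (\<exists>u1 v1 u2 v2. e1 = {u1, v1} \<and> e2 = {u2, v2} \<and>
           gdist G u1 u2 + gdist G v1 v2 \<noteq> gdist G u1 v2 + gdist G v1 u2)}"

definition theta_star_partition :: "'a ugraph \<Rightarrow> 'a set set set" where
  "theta_star_partition G = edges G // (djokovic_winkler G)\<^sup>+"

definition coarser_than_theta_star :: "'a ugraph \<Rightarrow> 'a set set set \<Rightarrow> bool" where
  "coarser_than_theta_star G P \<longleftrightarrow>
     partition_on (edges G) P \<and>
     (\<forall>F \<in> P. \<exists>S. S \<noteq> {} \<and> S \<subseteq> theta_star_partition G \<and> F = \<Union>S)"

definition delete_edges :: "'a ugraph \<Rightarrow> 'a set set \<Rightarrow> 'a ugraph" where
  "delete_edges G F = G\<lparr>edges := edges G - F\<rparr>"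

text \<open>A connected component is represented by its vertex set.\<close>

definition components :: "'a ugraph \<Rightarrow> 'a set set" where
  "components G = {{v. \<exists>p. path G u p v} | u. u \<in> verts G}"

definition quotient_graph :: "'a ugraph \<Rightarrow> 'a set set \<Rightarrow> 'a set ugraph" where
  "quotient_graph G F =
     \<lparr>verts = components (delete_edges G F),
      edges = {{C1, C2} | C1 C2.
        C1 \<in> components (delete_edges G F) \<and> C2 \<in> components (delete_edges G F) \<and> C1 \<noteq> C2 \<and>
        (\<exists>x \<in> C1. \<exists>y \<in> C2. {x, y} \<in> edges G)}\<rparr>"

end

theory Submission
  imports Defs
begin

text \<open>
  An edge of a geodesic \<open>p\<^sub>0, \<dots>, p\<^sub>n\<close> in a union \<open>F\<close> of \<open>\<Theta>\<^sup>*\<close>-classes is detected by the potential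
  \<open>\<Phi>(z) = \<Sum>\<^sub>i d(z, p\<^sub>i) - d(z, p\<^sub>i\<^sub>+\<^sub>1)\<close>, summed over those \<open>i\<close> whose edge lies in \<open>F\<close>: it grows by
  twice the number of these edges between the ends of the geodesic, is constant along the edges
  outside \<open>F\<close>, and changes by at most 2 along an edge in \<open>F\<close>, since there the missing summands
  vanish and the full sum telescopes. So \<open>\<Phi>\<close> factors through \<open>G/F\<close>, and the distance in \<open>G/F\<close> is
  exactly the number of edges of the geodesic in \<open>F\<close>. Summing over the partition, distances in \<open>G\<close>
  are the sums of the distances in the quotients. The orbit-stabilizer theorem turns the sum over
  the automorphisms into sums over pairs of vertices of the same orbit.
\<close>

section \<open>Walks and distances\<close>

text \<open>As a relation, so that walks of length n are the pairs in its n-th power and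
  reachability is its reflexive transitive closure. Walks may repeat vertices, so they concatenate
  and reverse freely.\<close>

definition adjacency :: "'a ugraph \<Rightarrow> 'a rel" where
  "adjacency G = {(u, v). {u, v} \<in> edges G}"

lemma adjacency_sym: "(u, v) \<in> adjacency G \<Longrightarrow> (v, u) \<in> adjacency G"
  by (simp add: adjacency_def insert_commute)

lemma sym_relpow: "sym r \<Longrightarrow> (x, y) \<in> r ^^ n \<Longrightarrow> (y, x) \<in> r ^^ n"
proof (induction n arbitrary: y)
  case (Suc n)
  then obtain z where "(x, z) \<in> r ^^ n" "(z, y) \<in> r" by auto
  then show ?case using Suc by (meson relpow_Suc_I2 symD)
qed auto

lemma sym_adjacency: "sym (adjacency G)"
  by (auto intro: symI adjacency_sym)

lemma path_imp_walk:
  assumes "path G x p y"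
  shows "(x, y) \<in> adjacency G ^^ (length p - 1)"
proof -
  have "(p ! 0, p ! (length p - 1)) \<in> adjacency G ^^ (length p - 1)"
    unfolding relpow_fun_conv
    using assms by (intro exI[of _ "(!) p"])
      (auto simp: path_def adjacency_def successively_conv_nth)
  then show ?thesis
    using assms by (metis path_def hd_conv_nth last_conv_nth)
qed

text \<open>Kept apart from connectedness because it is also used for
  \<open>delete_edges G F\<close>, which may be disconnected.\<close>

locale ugraph =
  fixes G :: "'a ugraph"
  assumes edge_subset: "e \<in> edges G \<Longrightarrow> e \<subseteq> verts G"
begin

text \<open>Induction along the walk: if the new end vertex already lies on the path, the path is
  cut off there; otherwise the vertex is appended.\<close>

lemma walk_imp_path:
  assumes "(x, y) \<in> adjacency G ^^ n" "x \<in> verts G"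
  shows "\<exists>p. path G x p y \<and> length p \<le> Suc n"
  using assms(1)
proof (induction n arbitrary: y)
  case 0
  then have "path G x [x] y" using assms(2) by (simp add: path_def)
  then show ?case by force
next
  case (Suc n)
  then obtain z where z: "(x, z) \<in> adjacency G ^^ n" "{z, y} \<in> edges G"
    by (auto simp: adjacency_def)
  with Suc.IH obtain p where p: "path G x p z" "length p \<le> Suc n" by blast
  show ?case
  proof (cases "y \<in> set p")
    case True
    then obtain ps qs where pq: "p = ps @ y # qs" by (meson split_list)
    with p have "path G x (ps @ [y]) y"
      using successively_append_iff[of "\<lambda>u v. {u, v} \<in> edges G" "ps @ [y]" qs]
      by (cases ps) (auto simp: path_def)
    then show ?thesis using p(2) pq by force
  next
    case False
    with p z edge_subset have "path G x (p @ [y]) y"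
      by (auto simp: path_def successively_append_iff)
    then show ?thesis using p(2) by force
  qed
qed

lemma reachable_iff_path:
  "x \<in> verts G \<Longrightarrow> (x, y) \<in> (adjacency G)\<^sup>* \<longleftrightarrow> (\<exists>p. path G x p y)"
  by (meson path_imp_walk relpow_imp_rtrancl rtrancl_imp_relpow walk_imp_path)

text \<open>Lets every later upper bound on a distance be proved by exhibiting a walk, with no check
  that its vertices are distinct.\<close>

lemma gdist_le:
  assumes "(x, y) \<in> adjacency G ^^ n" "x \<in> verts G"
  shows "gdist G x y \<le> n"
proof -
  obtain p where p: "path G x p y" "length p \<le> Suc n" using walk_imp_path[OF assms] by blast
  then have "length p = Suc (length p - 1)" by (simp add: path_def)
  with p(1) have "gdist G x y \<le> length p - 1"
    unfolding gdist_def by (intro Least_le) blast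
  with p(2) show ?thesis by linarith
qed

end

section \<open>The metric of a connected graph and its geodesics\<close>

locale connected_ugraph = ugraph +
  assumes connected: "x \<in> verts G \<Longrightarrow> y \<in> verts G \<Longrightarrow> (x, y) \<in> (adjacency G)\<^sup>*"
begin

lemma gdist_walk:
  assumes "x \<in> verts G" "y \<in> verts G"
  shows "(x, y) \<in> adjacency G ^^ gdist G x y"
proof -
  obtain p where p: "path G x p y" 
    using connected[OF assms] reachable_iff_path[OF assms(1)] by blast
  then have "length p = Suc (length p - 1)" by (simp add: path_def)
  with p have "\<exists>n p. path G x p y \<and> length p = Suc n" by blast
  then have "\<exists>p. path G x p y \<and> length p = Suc (gdist G x y)"
    unfolding gdist_def by (rule LeastI_ex)
  then obtain q where "path G x q y" "length q = Suc (gdist G x y)" by blast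
  then show ?thesis using path_imp_walk[of G x q y] by simp
qed

lemma gdist_triangle:
  assumes "x \<in> verts G" "y \<in> verts G" "z \<in> verts G"
  shows "gdist G x z \<le> gdist G x y + gdist G y z"
  using gdist_walk[OF assms(1,2)] gdist_walk[OF assms(2,3)] assms(1)
  by (intro gdist_le) (auto simp: relpow_add)

lemma gdist_commute:
  assumes "x \<in> verts G" "y \<in> verts G"
  shows "gdist G x y = gdist G y x"
proof -
  have "gdist G v u \<le> gdist G u v" if "u \<in> verts G" "v \<in> verts G" for u v
    using sym_relpow[OF sym_adjacency gdist_walk[OF that]] that(2) by (rule gdist_le)
  with assms show ?thesis by (simp add: antisym)
qed

text \<open>Distances from both ends are recorded because the potential of the main argument is
  evaluated at both ends.\<close>

definition geodesic :: "(nat \<Rightarrow> 'a) \<Rightarrow> nat \<Rightarrow> bool" where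
  "geodesic p n \<longleftrightarrow> p ` {..n} \<subseteq> verts G \<and> (\<forall>i<n. {p i, p (Suc i)} \<in> edges G) \<and>
     (\<forall>i\<le>n. gdist G (p 0) (p i) = i \<and> gdist G (p n) (p i) = n - i)"

lemma geodesic_exists:
  assumes "x \<in> verts G" "y \<in> verts G"
  obtains p where "geodesic p (gdist G x y)" "p 0 = x" "p (gdist G x y) = y"
proof -
  let ?n = "gdist G x y"
  obtain p where p: "p 0 = x" "p ?n = y" "\<And>i. i < ?n \<Longrightarrow> {p i, p (Suc i)} \<in> edges G"
    using gdist_walk[OF assms] unfolding relpow_fun_conv by (auto simp: adjacency_def)
  have in_verts: "p i \<in> verts G" if "i \<le> ?n" for i
    using that assms(1) p edge_subset by (cases i) (auto simp: Suc_le_eq)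
  \<comment> \<open>The two segments of the walk at \<open>p i\<close> bound the distances to its
    ends by i and n - i, where n is the distance of x and y; the triangle inequality then forces
    equality in both.\<close>
  have le1: "gdist G x (p i) \<le> i" if "i \<le> ?n" for i
    using that p assms(1) by (intro gdist_le)
      (auto simp: relpow_fun_conv adjacency_def intro!: exI[of _ p])
  have le2: "gdist G (p i) y \<le> ?n - i" if "i \<le> ?n" for i
    using that p in_verts by (intro gdist_le)
      (auto simp: relpow_fun_conv adjacency_def intro!: exI[of _ "\<lambda>j. p (i + j)"])
  have "gdist G x (p i) = i \<and> gdist G y (p i) = ?n - i" if "i \<le> ?n" for i
    using le1[OF that] le2[OF that] gdist_triangle[OF assms(1) in_verts[OF that] assms(2)]
      gdist_commute[OF in_verts[OF that] assms(2)] that by linarith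
  with p in_verts have "geodesic p ?n" by (auto simp: geodesic_def)
  with p that show ?thesis by blast
qed

end

section \<open>Quotient graphs\<close>

definition component_of :: "'a ugraph \<Rightarrow> 'a \<Rightarrow> 'a set" where
  "component_of G u = (adjacency G)\<^sup>* `` {u}"

lemma component_of_self: "u \<in> component_of G u"
  by (simp add: component_of_def)

lemma component_of_eq_iff: "component_of G u = component_of G v \<longleftrightarrow> v \<in> component_of G u"
proof
  assume "v \<in> component_of G u"
  then have uv: "(u, v) \<in> (adjacency G)\<^sup>*" by (simp add: component_of_def)
  with sym_rtrancl[OF sym_adjacency] have "(v, u) \<in> (adjacency G)\<^sup>*" by (rule symD)
  with uv show "component_of G u = component_of G v"
    unfolding component_of_def by (blast intro: rtrancl_trans)
next
  assume "component_of G u = component_of G v"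
  then show "v \<in> component_of G u" by (simp add: component_of_self)
qed

lemma (in ugraph) components_eq: "components G = component_of G ` verts G"
proof -
  have "{v. \<exists>p. path G u p v} = component_of G u" if "u \<in> verts G" for u
    using reachable_iff_path[OF that] by (auto simp: component_of_def)
  then show ?thesis unfolding components_def by blast
qed

context connected_ugraph
begin

abbreviation (input) comp :: "'a set set \<Rightarrow> 'a \<Rightarrow> 'a set" where
  "comp F \<equiv> component_of (delete_edges G F)"

lemma ugraph_delete_edges: "ugraph (delete_edges G F)"
  using edge_subset by unfold_locales (auto simp: delete_edges_def)

lemma verts_quotient: "verts (quotient_graph G F) = comp F ` verts G"
  using ugraph.components_eq[OF ugraph_delete_edges, of F]
  by (simp add: quotient_graph_def delete_edges_def)

lemma quotient_adjacency_iff: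
  "(C, D) \<in> adjacency (quotient_graph G F) \<longleftrightarrow>
     C \<in> comp F ` verts G \<and> D \<in> comp F ` verts G \<and> C \<noteq> D \<and> (\<exists>x\<in>C. \<exists>y\<in>D. {x, y} \<in> edges G)"
  (is "?L \<longleftrightarrow> ?R")
proof
  have "components (delete_edges G F) = comp F ` verts G"
    using verts_quotient[of F] by (simp add: quotient_graph_def)
  moreover assume ?R
  ultimately show ?L
    unfolding adjacency_def quotient_graph_def by simp blast
next
  assume ?L
  then obtain A B where "{C, D} = {A, B}" and AB: "A \<in> comp F ` verts G"
    "B \<in> comp F ` verts G" "A \<noteq> B" "\<exists>x\<in>A. \<exists>y\<in>B. {x, y} \<in> edges G"
    using verts_quotient[of F] by (auto simp: adjacency_def quotient_graph_def)
  \<comment> \<open>An edge of the quotient is an unordered pair, so its ends are known only up to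
    exchange; the condition on A and B is symmetric.\<close>
  then have "C = A \<and> D = B \<or> C = B \<and> D = A" by (simp add: doubleton_eq_iff)
  moreover have "\<exists>x\<in>B. \<exists>y\<in>A. {x, y} \<in> edges G"
  proof -
    obtain x y where "x \<in> A" "y \<in> B" "{x, y} \<in> edges G" using AB(4) by blast
    moreover from this have "{y, x} \<in> edges G" by (simp add: insert_commute)
    ultimately show ?thesis by blast
  qed
  ultimately show ?R using AB by auto
qed

lemma comp_eq_if_edge: "{u, v} \<in> edges G - F \<Longrightarrow> comp F u = comp F v"
  by (subst component_of_eq_iff) (auto simp: component_of_def adjacency_def delete_edges_def)

lemma quotient_step:
  assumes "{u, v} \<in> edges G"
  shows "comp F u = comp F v \<or> (comp F u, comp F v) \<in> adjacency (quotient_graph G F)"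
proof -
  have "u \<in> verts G" "v \<in> verts G" using edge_subset[OF assms] by auto
  then show ?thesis
    unfolding quotient_adjacency_iff using component_of_self assms by fast
qed

text \<open>An edge outside F stays inside one component of G - F. An edge in F gives at most one
  step: its ends may still be joined in G - F, hence only an inequality.\<close>

lemma quotient_walk:
  assumes "\<And>i. i < n \<Longrightarrow> {p i, p (Suc i)} \<in> edges G"
  shows "\<exists>m \<le> card {i. i < n \<and> {p i, p (Suc i)} \<in> F}.
    (comp F (p 0), comp F (p n)) \<in> adjacency (quotient_graph G F) ^^ m"
  using assms
proof (induction n)
  case (Suc n)
  let ?I = "\<lambda>n. {i. i < n \<and> {p i, p (Suc i)} \<in> F}"
  let ?Q = "adjacency (quotient_graph G F)"
  from Suc obtain m where m: "m \<le> card (?I n)" "(comp F (p 0), comp F (p n)) \<in> ?Q ^^ m"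
    by force
  have e: "{p n, p (Suc n)} \<in> edges G" using Suc.prems by simp
  have le: "card (?I n) \<le> card (?I (Suc n))" by (rule card_mono) auto
  show ?case
  proof (cases "comp F (p n) = comp F (p (Suc n))")
    case True
    with m le show ?thesis by (intro exI[of _ m]) auto
  next
    case False
    with e have "{p n, p (Suc n)} \<in> F" using comp_eq_if_edge[of "p n" "p (Suc n)" F] by blast
    then have "?I (Suc n) = insert n (?I n)" by (auto simp: less_Suc_eq)
    then have "card (?I (Suc n)) = Suc (card (?I n))" by simp
    moreover have "(comp F (p 0), comp F (p (Suc n))) \<in> ?Q ^^ Suc m"
      using False quotient_step[OF e, of F] m(2) by auto
    ultimately show ?thesis using m(1) by (intro exI[of _ "Suc m"]) auto
  qed
qed auto

lemma connected_quotient: "connected_ugraph (quotient_graph G F)"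
proof
  show "e \<subseteq> verts (quotient_graph G F)" if "e \<in> edges (quotient_graph G F)" for e
    using that by (auto simp: quotient_graph_def)
  fix C D assume "C \<in> verts (quotient_graph G F)" "D \<in> verts (quotient_graph G F)"
  then obtain x y where xy: "x \<in> verts G" "y \<in> verts G" "C = comp F x" "D = comp F y"
    by (auto simp: verts_quotient)
  obtain p where "geodesic p (gdist G x y)" "p 0 = x" "p (gdist G x y) = y"
    using geodesic_exists xy by blast
  with quotient_walk[of "gdist G x y" p F] xy show "(C, D) \<in> (adjacency (quotient_graph G F))\<^sup>*"
    by (auto simp: geodesic_def intro: relpow_imp_rtrancl)
qed

text \<open>A lower bound for quotient distances: \<Phi> is constant on each component of G - F, and
  each step of a quotient walk is realised by an edge of G, along which \<Phi> grows by at most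
  2.\<close>

lemma potential_quotient_le:
  fixes \<Phi> :: "'a \<Rightarrow> int"
  assumes const: "\<And>u v. {u, v} \<in> edges G - F \<Longrightarrow> \<Phi> u = \<Phi> v"
    and step: "\<And>u v. {u, v} \<in> edges G \<Longrightarrow> \<Phi> v \<le> \<Phi> u + 2"
    and "x \<in> verts G" "y \<in> verts G"
  shows "\<Phi> y \<le> \<Phi> x + 2 * int (gdist (quotient_graph G F) (comp F x) (comp F y))"
proof -
  have comp_const: "\<Phi> u = \<Phi> v" if "v \<in> comp F u" for u v
  proof -
    have "(u, v) \<in> (adjacency (delete_edges G F))\<^sup>*" using that by (simp add: component_of_def)
    then show ?thesis
      by induction (use const in \<open>auto simp: adjacency_def delete_edges_def\<close>)
  qed
  \<comment> \<open>Claimed for every vertex y of D, since the edge of G realising the next step may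
    leave D at any of its vertices.\<close>
  have "\<Phi> y \<le> \<Phi> x + 2 * int m" if "(comp F x, D) \<in> adjacency (quotient_graph G F) ^^ m" "y \<in> D"
    for m D y
    using that
  proof (induction m arbitrary: D y)
    case 0
    then show ?case using comp_const[of y x] by auto
  next
    case (Suc m)
    then obtain C where C: "(comp F x, C) \<in> adjacency (quotient_graph G F) ^^ m"
      "(C, D) \<in> adjacency (quotient_graph G F)" by auto
    then obtain u v where uv: "u \<in> C" "v \<in> D" "{u, v} \<in> edges G"
      unfolding quotient_adjacency_iff by blast
    obtain w where "D = comp F w" using C(2) unfolding quotient_adjacency_iff by blast
    then have "\<Phi> y = \<Phi> v" using comp_const[of y w] comp_const[of v w] uv(2) Suc.prems(2) by simp
    with Suc.IH[OF C(1) uv(1)] step[OF uv(3)] show ?case by simp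
  qed
  moreover have "(comp F x, comp F y) \<in> adjacency (quotient_graph G F) ^^
      gdist (quotient_graph G F) (comp F x) (comp F y)"
    using assms(3,4) by (intro connected_ugraph.gdist_walk connected_quotient)
      (simp_all add: verts_quotient)
  ultimately show ?thesis using component_of_self by fast
qed

end

section \<open>Distances in quotients by unions of classes\<close>

context connected_ugraph
begin

section \<open>Edge sets closed under the relation \<Theta>\<close>

lemma djokovic_winklerI:
  assumes "{u1, v1} \<in> edges G" "{u2, v2} \<in> edges G"
    and "gdist G u1 u2 + gdist G v1 v2 \<noteq> gdist G u1 v2 + gdist G v1 u2"
  shows "({u1, v1}, {u2, v2}) \<in> djokovic_winkler G"
proof -
  have "\<exists>a b c d. {u1, v1} = {a, b} \<and> {u2, v2} = {c, d} \<and>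
      gdist G a c + gdist G b d \<noteq> gdist G a d + gdist G b c"
    by (rule exI[of _ u1], rule exI[of _ v1], rule exI[of _ u2], rule exI[of _ v2])
      (use assms(3) in simp)
  with assms(1,2) show ?thesis by (simp only: djokovic_winkler_def mem_Collect_eq case_prod_conv)
qed

lemma sym_djokovic_winkler: "sym (djokovic_winkler G)"
proof (rule symI)
  fix e f assume "(e, f) \<in> djokovic_winkler G"
  then obtain u1 v1 u2 v2 where *: "e \<in> edges G" "f \<in> edges G" "e = {u1, v1}" "f = {u2, v2}"
    "gdist G u1 u2 + gdist G v1 v2 \<noteq> gdist G u1 v2 + gdist G v1 u2"
    unfolding djokovic_winkler_def by blast
  then have "u1 \<in> verts G" "v1 \<in> verts G" "u2 \<in> verts G" "v2 \<in> verts G"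
    using edge_subset by auto
  then have "gdist G u2 u1 = gdist G u1 u2" "gdist G v2 v1 = gdist G v1 v2"
    "gdist G u2 v1 = gdist G v1 u2" "gdist G v2 u1 = gdist G u1 v2"
    by (auto intro!: gdist_commute)
  with *(5) have "gdist G u2 u1 + gdist G v2 v1 \<noteq> gdist G u2 v1 + gdist G v2 u1" by simp
  with *(1-4) have "({u2, v2}, {u1, v1}) \<in> djokovic_winkler G" by (intro djokovic_winklerI) auto
  with *(3,4) show "(f, e) \<in> djokovic_winkler G" by simp
qed

text \<open>Saturation under \<Theta> itself already gives saturation under its transitive closure,
  so the closure need not be handled beyond the next lemma.\<close>

definition theta_closed :: "'a set set \<Rightarrow> bool" where
  "theta_closed F \<longleftrightarrow> (\<forall>(e, f) \<in> djokovic_winkler G. e \<in> F \<longleftrightarrow> f \<in> F)"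

lemma theta_closed_Union:
  assumes "S \<subseteq> theta_star_partition G"
  shows "theta_closed (\<Union>S)"
proof -
  have "f \<in> \<Union>S" if "(e, f) \<in> djokovic_winkler G" "e \<in> \<Union>S" for e f
  proof -
    from that(2) obtain X where X: "X \<in> S" "e \<in> X" by blast
    with assms have "X \<in> edges G // (djokovic_winkler G)\<^sup>+"
      by (auto simp: theta_star_partition_def)
    then obtain e0 where "X = (djokovic_winkler G)\<^sup>+ `` {e0}"
      by (rule quotientE)
    with X that(1) have "f \<in> X" by (auto intro: trancl_into_trancl)
    with X show ?thesis by blast
  qed
  moreover have "(f, e) \<in> djokovic_winkler G" if "(e, f) \<in> djokovic_winkler G" for e f
    using sym_djokovic_winkler that by (rule symD)
  ultimately show ?thesis
    unfolding theta_closed_def by blast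
qed

text \<open>An edge in F and an edge outside F are never \<Theta>-related; the resulting equality of
  distance sums, rearranged over the integers, says that d(z, a) - d(z, b) does not change between z
  = u and z = v.\<close>

lemma theta_closed_balance:
  assumes "theta_closed F" "{u, v} \<in> edges G" "{a, b} \<in> edges G"
    and "{u, v} \<in> F \<longleftrightarrow> {a, b} \<notin> F"
  shows "int (gdist G u a) - int (gdist G u b) = int (gdist G v a) - int (gdist G v b)"
proof (rule ccontr)
  assume "\<not> ?thesis"
  then have "gdist G u a + gdist G v b \<noteq> gdist G u b + gdist G v a" by linarith
  then have "({u, v}, {a, b}) \<in> djokovic_winkler G"
    using assms(2,3) by (intro djokovic_winklerI)
  with assms(1) have "{u, v} \<in> F \<longleftrightarrow> {a, b} \<in> F" by (auto simp: theta_closed_def)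
  with assms(4) show False by simp
qed

theorem gdist_quotient:
  assumes closed: "theta_closed F" and geo: "geodesic p n"
  shows "gdist (quotient_graph G F) (comp F (p 0)) (comp F (p n)) =
    card {i. i < n \<and> {p i, p (Suc i)} \<in> F}"
proof (rule antisym)
  let ?I = "{i. i < n \<and> {p i, p (Suc i)} \<in> F}"
  have edge: "{p i, p (Suc i)} \<in> edges G" if "i < n" for i
    using geo that by (simp add: geodesic_def)
  have verts: "p i \<in> verts G" if "i \<le> n" for i
    using geo that by (auto simp: geodesic_def)
  interpret Q: connected_ugraph "quotient_graph G F" by (rule connected_quotient)
  \<comment> \<open>Upper bound: the geodesic itself projects to a walk in the quotient.\<close>
  obtain m where "m \<le> card ?I" "(comp F (p 0), comp F (p n)) \<in> adjacency (quotient_graph G F) ^^ m"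
    using quotient_walk[of n p F] edge by blast
  then show "gdist (quotient_graph G F) (comp F (p 0)) (comp F (p n)) \<le> card ?I"
    using Q.gdist_le[of "comp F (p 0)" "comp F (p n)" m] verts[of 0] by (simp add: verts_quotient)
  define \<delta> where "\<delta> z i = int (gdist G z (p i)) - int (gdist G z (p (Suc i)))" for z i
  define \<Phi> where "\<Phi> z = (\<Sum>i\<in>?I. \<delta> z i)" for z
  have "\<Phi> u = \<Phi> v" if "{u, v} \<in> edges G - F" for u v
    unfolding \<Phi>_def \<delta>_def
    by (rule sum.cong[OF refl]) (use theta_closed_balance[OF closed] that edge in auto)
  moreover have "\<Phi> v \<le> \<Phi> u + 2" if uv: "{u, v} \<in> edges G" for u v
  proof (cases "{u, v} \<in> F")
    case True
    have in_verts: "u \<in> verts G" "v \<in> verts G" using edge_subset[OF uv] by auto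
    have "\<Phi> v - \<Phi> u = (\<Sum>i\<in>?I. \<delta> v i - \<delta> u i)" by (simp add: \<Phi>_def sum_subtractf)
    also have "\<dots> = (\<Sum>i<n. \<delta> v i - \<delta> u i)"
    proof (rule sum.mono_neutral_left)
      show "\<forall>i\<in>{..<n} - ?I. \<delta> v i - \<delta> u i = 0"
        using theta_closed_balance[OF closed uv edge] True by (auto simp: \<delta>_def)
    qed auto
    also have "\<dots> = (\<Sum>i<n. \<delta> v i) - (\<Sum>i<n. \<delta> u i)" by (simp add: sum_subtractf)
    also have "\<dots> = (int (gdist G v (p 0)) - int (gdist G v (p n)))
        - (int (gdist G u (p 0)) - int (gdist G u (p n)))"
      unfolding \<delta>_def
        sum_lessThan_telescope'[of "\<lambda>i. int (gdist G v (p i))"]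
        sum_lessThan_telescope'[of "\<lambda>i. int (gdist G u (p i))"] ..
    \<comment> \<open>Adjacent u and v have distances to any vertex that differ by at most 1; the
      ends \<open>p 0\<close> and \<open>p n\<close> contribute 1 each.\<close>
    also have "\<dots> \<le> 2"
    proof -
      have adj: "gdist G u v \<le> 1" "gdist G v u \<le> 1"
        using in_verts uv by (auto intro!: gdist_le simp: adjacency_def insert_commute)
      show ?thesis
        using gdist_triangle[OF in_verts(2,1) verts[of 0]] gdist_triangle[OF in_verts verts[of n]]
          adj by auto
    qed
    finally show ?thesis by simp
  next
    case False
    \<comment> \<open>Here \<open>calculation\<close> is the constancy of \<Phi> along edges outside
      F.\<close>
    then show ?thesis using calculation uv by force
  qed
  ultimately have "\<Phi> (p n) \<le> \<Phi> (p 0) +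
      2 * int (gdist (quotient_graph G F) (comp F (p 0)) (comp F (p n)))"
    using verts by (intro potential_quotient_le) auto
  moreover have "\<Phi> (p 0) = - int (card ?I)"
  proof -
    \<comment> \<open>Each summand is i - (i + 1).\<close>
    have "\<Phi> (p 0) = (\<Sum>i\<in>?I. - 1)"
      unfolding \<Phi>_def \<delta>_def using geo by (intro sum.cong) (auto simp: geodesic_def)
    then show ?thesis by simp
  qed
  moreover have "\<Phi> (p n) = int (card ?I)"
  proof -
    \<comment> \<open>Each summand is (n - i) - (n - (i + 1)); \<open>of_nat_diff\<close> resolves
      the truncated subtractions, legitimate as i < n.\<close>
    have "\<Phi> (p n) = (\<Sum>i\<in>?I. 1)"
      unfolding \<Phi>_def \<delta>_def using geo
      by (intro sum.cong) (auto simp: geodesic_def of_nat_diff)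
    then show ?thesis by simp
  qed
  ultimately show "card ?I \<le> gdist (quotient_graph G F) (comp F (p 0)) (comp F (p n))"
    by linarith
qed

text \<open>Double counting along one geodesic from x to y, used for all F at once: each of its
  edges lies in exactly one member of P.\<close>

theorem gdist_eq_sum_quotients:
  assumes P: "coarser_than_theta_star G P" "finite P" and xy: "x \<in> verts G" "y \<in> verts G"
  shows "gdist G x y = (\<Sum>F\<in>P. gdist (quotient_graph G F) (comp F x) (comp F y))"
proof -
  let ?n = "gdist G x y"
  obtain p where p: "geodesic p ?n" "p 0 = x" "p ?n = y"
    using geodesic_exists[OF xy] .
  have "theta_closed F" if "F \<in> P" for F
    using P(1) that theta_closed_Union by (auto simp: coarser_than_theta_star_def)
  then have "(\<Sum>F\<in>P. gdist (quotient_graph G F) (comp F x) (comp F y)) =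
      (\<Sum>F\<in>P. card {i. i < ?n \<and> {p i, p (Suc i)} \<in> F})"
    using gdist_quotient[OF _ p(1)] p(2,3) by simp
  also have "\<dots> = (\<Sum>F\<in>P. \<Sum>i | i \<in> {..<?n} \<and> {p i, p (Suc i)} \<in> F. 1)" by simp
  also have "\<dots> = (\<Sum>i<?n. \<Sum>F | F \<in> P \<and> {p i, p (Suc i)} \<in> F. 1)"
    using P(2) by (intro sum.swap_restrict) auto
  also have "\<dots> = (\<Sum>i<?n. 1)"
  proof (rule sum.cong[OF refl])
    fix i assume "i \<in> {..<?n}"
    then have "{p i, p (Suc i)} \<in> edges G" using p(1) by (simp add: geodesic_def)
    then obtain F where "F \<in> P" "{p i, p (Suc i)} \<in> F"
      using P(1) by (metis UnionE coarser_than_theta_star_def partition_onD1)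
    moreover have "disjoint P" using P(1) by (auto simp: coarser_than_theta_star_def partition_on_def)
    ultimately have "{F \<in> P. {p i, p (Suc i)} \<in> F} = {F}" by (auto dest: disjointD)
    then show "(\<Sum>F | F \<in> P \<and> {p i, p (Suc i)} \<in> F. 1) = (1 :: nat)" by simp
  qed
  finally show ?thesis by simp
qed

text \<open>The weight of C counts the vertices of W that \<open>comp F\<close> sends to C, so a
  weighted sum over components is a plain sum over W.\<close>

lemma weighted_wiener_quotient:
  assumes "finite (verts G)" "W \<subseteq> verts G"
  shows "weighted_wiener (quotient_graph G F) (\<lambda>C. real (card (W \<inter> C))) =
    1 / 2 * (\<Sum>u\<in>W. \<Sum>v\<in>W. real (gdist (quotient_graph G F) (comp F u) (comp F v)))"
proof -
  let ?Q = "quotient_graph G F"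
  have fibre: "{u \<in> W. comp F u = C} = W \<inter> C" if "C \<in> verts ?Q" for C
  proof -
    obtain w where "C = comp F w" using \<open>C \<in> verts ?Q\<close> by (auto simp: verts_quotient)
    moreover have "comp F u = comp F w \<longleftrightarrow> u \<in> comp F w" for u
      using component_of_eq_iff[of "delete_edges G F" w u] by (simp add: eq_commute)
    ultimately show ?thesis by blast
  qed
  have fin: "finite W" "finite (verts ?Q)"
    using assms finite_subset[OF assms(2,1)] by (simp_all add: verts_quotient)
  \<comment> \<open>For arbitrary g, because it is applied to both the inner and the outer
    sum.\<close>
  have group: "(\<Sum>C\<in>verts ?Q. real (card (W \<inter> C)) * g C) = (\<Sum>u\<in>W. g (comp F u))" for g
  proof -
    have "(\<Sum>u\<in>W. g (comp F u)) = (\<Sum>C\<in>verts ?Q. \<Sum>u | u \<in> W \<and> comp F u = C. g (comp F u))"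
      by (rule sum.group[symmetric]) (use fin assms(2) in \<open>auto simp: verts_quotient\<close>)
    also have "\<dots> = (\<Sum>C\<in>verts ?Q. \<Sum>u | u \<in> W \<and> comp F u = C. g C)"
      by (intro sum.cong) auto
    also have "\<dots> = (\<Sum>C\<in>verts ?Q. real (card (W \<inter> C)) * g C)"
      by (intro sum.cong) (simp_all add: fibre)
    finally show ?thesis by simp
  qed
  have "(\<Sum>C\<in>verts ?Q. \<Sum>D\<in>verts ?Q. real (card (W \<inter> C)) * real (card (W \<inter> D)) * real (gdist ?Q C D))
      = (\<Sum>C\<in>verts ?Q. real (card (W \<inter> C)) *
          (\<Sum>D\<in>verts ?Q. real (card (W \<inter> D)) * real (gdist ?Q C D)))"
    by (simp add: sum_distrib_left mult.assoc)
  also have "\<dots> = (\<Sum>u\<in>W. \<Sum>v\<in>W. real (gdist ?Q (comp F u) (comp F v)))"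
    by (simp add: group)
  finally show ?thesis by (simp add: weighted_wiener_def)
qed

end

section \<open>Averaging over a group action\<close>

text \<open>The elements sending x to the same point as h form the left coset of the stabilizer by
  h.\<close>

lemma (in group_action) card_transporter:
  assumes "x \<in> E" "h \<in> carrier G"
  shows "card {g \<in> carrier G. \<phi> g x = \<phi> h x} = card (stabilizer G \<phi> x)"
proof -
  interpret group G using group_hom group_hom.axioms(1) by auto
  have "bij_betw (\<lambda>g. h \<otimes> g) (stabilizer G \<phi> x) {g \<in> carrier G. \<phi> g x = \<phi> h x}"
  proof (rule bij_betw_byWitness[where f' = "\<lambda>g. inv h \<otimes> g"])
    show "(\<lambda>g. h \<otimes> g) ` stabilizer G \<phi> x \<subseteq> {g \<in> carrier G. \<phi> g x = \<phi> h x}"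
      using assms by (auto simp: stabilizer_def composition_rule)
    show "(\<lambda>g. inv h \<otimes> g) ` {g \<in> carrier G. \<phi> g x = \<phi> h x} \<subseteq> stabilizer G \<phi> x"
      using assms orbit_sym_aux[OF assms(2,1) refl] by (auto simp: stabilizer_def composition_rule)
  qed (use assms in \<open>auto simp: stabilizer_def m_assoc[symmetric]\<close>)
  then show ?thesis by (simp add: bij_betw_same_card)
qed

text \<open>Each point of the orbit is hit by as many group elements as the stabilizer has, which
  the orbit-stabilizer theorem expresses through the orbit size.\<close>

lemma (in group_action) sum_over_group:
  fixes f :: "_ \<Rightarrow> real"
  assumes "x \<in> E" "finite (carrier G)"
  shows "(\<Sum>g\<in>carrier G. f (\<phi> g x)) =
    real (order G) / real (card (orbit G \<phi> x)) * (\<Sum>y\<in>orbit G \<phi> x. f y)"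
proof -
  let ?O = "orbit G \<phi> x"
  have O: "?O = (\<lambda>g. \<phi> g x) ` carrier G" by (auto simp: orbit_def)
  then have fin: "finite ?O" using assms(2) by simp
  have "(\<Sum>g\<in>carrier G. f (\<phi> g x)) = (\<Sum>y\<in>?O. \<Sum>g | g \<in> carrier G \<and> \<phi> g x = y. f (\<phi> g x))"
    by (rule sum.group[symmetric]) (use assms fin O in auto)
  also have "\<dots> = (\<Sum>y\<in>?O. real (card (stabilizer G \<phi> x)) * f y)"
  proof (rule sum.cong[OF refl])
    fix y assume "y \<in> ?O"
    then have "card {g \<in> carrier G. \<phi> g x = y} = card (stabilizer G \<phi> x)"
      using card_transporter[OF assms(1)] O by auto
    then show "(\<Sum>g | g \<in> carrier G \<and> \<phi> g x = y. f (\<phi> g x)) =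
        real (card (stabilizer G \<phi> x)) * f y" by simp
  qed
  also have "\<dots> = real (card (stabilizer G \<phi> x)) * (\<Sum>y\<in>?O. f y)"
    by (simp add: sum_distrib_left)
  also have "real (card (stabilizer G \<phi> x)) = real (order G) / real (card ?O)"
  proof -
    have "card ?O \<noteq> 0" using orbit_refl[OF assms(1)] fin by auto
    moreover have "real (card ?O) * real (card (stabilizer G \<phi> x)) = real (order G)"
      using orbit_stabilizer_theorem[OF assms(1)] by (simp flip: of_nat_mult)
    ultimately show ?thesis by (simp add: field_simps)
  qed
  finally show ?thesis .
qed

lemma (in group_action) orbit_eq:
  assumes "V \<in> orbits G E \<phi>" "x \<in> V"
  shows "orbit G \<phi> x = V"
proof -
  have "x \<in> E" using assms orbits_coverture by blast
  then have "orbit G \<phi> x \<in> orbits G E \<phi>" "x \<in> orbit G \<phi> x"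
    using orbit_refl by (auto simp: orbits_def)
  with assms disjoint_union show ?thesis by blast
qed

lemma (in group_action) sum_over_orbits:
  fixes f :: "_ \<Rightarrow> _ \<Rightarrow> real"
  assumes "finite E" "finite (carrier G)"
  shows "(\<Sum>x\<in>E. \<Sum>g\<in>carrier G. f x (\<phi> g x)) =
    real (order G) * (\<Sum>V\<in>orbits G E \<phi>. 1 / real (card V) * (\<Sum>x\<in>V. \<Sum>y\<in>V. f x y))"
proof -
  have "(\<Sum>x\<in>E. \<Sum>g\<in>carrier G. f x (\<phi> g x)) =
      (\<Sum>V\<in>orbits G E \<phi>. \<Sum>x\<in>V. \<Sum>g\<in>carrier G. f x (\<phi> g x))"
    using assms(1) by (simp add: disjoint_sum)
  also have "\<dots> = (\<Sum>V\<in>orbits G E \<phi>. \<Sum>x\<in>V. real (order G) / real (card V) * (\<Sum>y\<in>V. f x y))"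
  proof (intro sum.cong refl)
    fix V x assume V: "V \<in> orbits G E \<phi>" "x \<in> V"
    then have "x \<in> E" using orbits_coverture by blast
    then show "(\<Sum>g\<in>carrier G. f x (\<phi> g x)) = real (order G) / real (card V) * (\<Sum>y\<in>V. f x y)"
      using sum_over_group[of x "f x"] assms(2) orbit_eq[OF V] by simp
  qed
  finally show ?thesis by (simp add: sum_distrib_left sum_divide_distrib)
qed

lemma aut_group_action:
  "group_action (aut_group G) (verts G) (\<lambda>\<alpha> u. \<alpha> u)"
proof -
  let ?S = "verts G" and ?B = "BijGroup (verts G)"
  let ?A = "{\<alpha> \<in> Bij ?S. \<forall>u\<in>?S. \<forall>v\<in>?S. {\<alpha> u, \<alpha> v} \<in> edges G \<longleftrightarrow> {u, v} \<in> edges G}"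
  interpret B: group ?B by (rule group_BijGroup)
  have sub: "subgroup ?A ?B"
  proof (rule B.subgroupI)
    show "?A \<subseteq> carrier ?B" by (auto simp: BijGroup_def)
    show "?A \<noteq> {}" using id_Bij[of ?S] by (auto intro!: exI[of _ "\<lambda>x\<in>?S. x"])
    show "inv\<^bsub>?B\<^esub> \<alpha> \<in> ?A" if \<alpha>: "\<alpha> \<in> ?A" for \<alpha>
    proof -
      let ?\<beta> = "\<lambda>x\<in>?S. inv_into ?S \<alpha> x"
      have "\<alpha> (inv_into ?S \<alpha> u) = u" "inv_into ?S \<alpha> u \<in> ?S" if "u \<in> ?S" for u
        using \<alpha> that Bij_inv_into_mem[of \<alpha> ?S u]
        by (auto simp: Bij_def bij_betw_def f_inv_into_f)
      \<comment> \<open>Applied to the preimages of two vertices, this equivalence becomes the one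
        required of the inverse.\<close>
      moreover from \<alpha> have "{\<alpha> u, \<alpha> v} \<in> edges G \<longleftrightarrow> {u, v} \<in> edges G"
        if "u \<in> ?S" "v \<in> ?S" for u v using that by blast
      ultimately have "{?\<beta> u, ?\<beta> v} \<in> edges G \<longleftrightarrow> {u, v} \<in> edges G" if "u \<in> ?S" "v \<in> ?S" for u v
        using that by (metis restrict_apply')
      then show ?thesis using \<alpha> by (auto simp: inv_BijGroup restrict_inv_into_Bij)
    qed
    show "\<alpha> \<otimes>\<^bsub>?B\<^esub> \<beta> \<in> ?A" if "\<alpha> \<in> ?A" "\<beta> \<in> ?A" for \<alpha> \<beta>
    proof -
      have "\<beta> u \<in> ?S" if "u \<in> ?S" for u
        using that \<open>\<beta> \<in> ?A\<close> Bij_imp_funcset[of \<beta> ?S] by auto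
      with that show ?thesis by (auto simp: BijGroup_def compose_Bij compose_eq)
    qed
  qed
  have "group (aut_group G)"
    unfolding aut_group_def by (rule B.subgroup_imp_group[OF sub])
  \<comment> \<open>An action is a homomorphism into the bijections; the natural one is the
    inclusion of the subgroup.\<close>
  moreover have "(\<lambda>\<alpha> u. \<alpha> u) \<in> hom (aut_group G) ?B"
    by (rule homI) (auto simp: aut_group_def BijGroup_def)
  ultimately show ?thesis
    by (simp add: group_action_def group_hom_def group_hom_axioms_def group_BijGroup)
qed

text \<open>Automorphisms are extensional, hence determined by their values on the finite vertex
  set.\<close>

lemma finite_aut_group:
  assumes "finite (verts G)"
  shows "finite (carrier (aut_group G))"
proof (rule finite_subset)
  show "carrier (aut_group G) \<subseteq> (\<Pi>\<^sub>E u\<in>verts G. verts G)"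
    by (auto simp: aut_group_def PiE_def Bij_imp_extensional dest: Bij_imp_funcset)
  show "finite (\<Pi>\<^sub>E u\<in>verts G. verts G)" using assms by (intro finite_PiE) auto
qed

section \<open>The Graovac-Pisanski index\<close>

lemma graovac_pisanski_orbits:
  assumes "finite (verts G)"
  shows "graovac_pisanski G = real (card (verts G)) *
    (\<Sum>W\<in>vertex_orbits G. 1 / real (card W) * (1 / 2 * (\<Sum>u\<in>W. \<Sum>v\<in>W. real (gdist G u v))))"
proof -
  interpret A: group_action "aut_group G" "verts G" "\<lambda>\<alpha> u. \<alpha> u" by (rule aut_group_action)
  interpret group "aut_group G" using A.group_hom group_hom.axioms(1) by auto
  let ?c = "real (card (carrier (aut_group G)))"
  let ?T = "\<Sum>W\<in>vertex_orbits G. 1 / real (card W) * (\<Sum>u\<in>W. \<Sum>v\<in>W. real (gdist G u v))"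
  have "?c \<noteq> 0" using finite_aut_group[OF assms] one_closed by auto
  \<comment> \<open>The group order from averaging cancels against the one in the definition of the
    index; it is nonzero because of the identity.\<close>
  then have "graovac_pisanski G = real (card (verts G)) * (1 / 2 * ?T)"
    using A.sum_over_orbits[OF assms finite_aut_group[OF assms], of "\<lambda>u v. real (gdist G u v)"]
    by (simp add: graovac_pisanski_def vertex_orbits_def order_def)
  also have "1 / 2 * ?T = (\<Sum>W\<in>vertex_orbits G.
      1 / real (card W) * (1 / 2 * (\<Sum>u\<in>W. \<Sum>v\<in>W. real (gdist G u v))))"
    by (subst sum_distrib_left) (intro sum.cong refl, simp)
  finally show ?thesis .
qed

theorem theorem3p3:
  fixes G :: "'a ugraph"
    and V :: "nat \<Rightarrow> 'a set" and t :: nat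
    and F :: "nat \<Rightarrow> 'a set set" and k :: nat
  assumes "finite_simple_graph G" and "connected_graph G"
    and "bij_betw V {1..t} (vertex_orbits G)"
    and "inj_on F {1..k}"
    and "coarser_than_theta_star G (F ` {1..k})"
  shows "graovac_pisanski G =
    real (card (verts G)) *
    (\<Sum>i = 1..t. 1 / real (card (V i)) *
      (\<Sum>j = 1..k. weighted_wiener (quotient_graph G (F j)) (\<lambda>C. real (card (V i \<inter> C)))))"
proof -
  have fin: "finite (verts G)" using assms(1) by (simp add: finite_simple_graph_def)
  interpret ugraph G
    using assms(1) by unfold_locales (auto simp: finite_simple_graph_def)
  interpret connected_ugraph G
    using assms(2) by unfold_locales (auto simp: connected_graph_def reachable_iff_path)
  interpret A: group_action "aut_group G" "verts G" "\<lambda>\<alpha> u. \<alpha> u" by (rule aut_group_action)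
  \<comment> \<open>For a single orbit: pass from weights to pairs of vertices, move the sum over j
    inside, and add up the quotient distances.\<close>
  have cut: "(\<Sum>j = 1..k. weighted_wiener (quotient_graph G (F j)) (\<lambda>C. real (card (W \<inter> C)))) =
      1 / 2 * (\<Sum>u\<in>W. \<Sum>v\<in>W. real (gdist G u v))" if "W \<in> vertex_orbits G" for W
  proof -
    have W: "W \<subseteq> verts G"
      using that A.orbits_coverture by (auto simp: vertex_orbits_def)
    let ?d = "\<lambda>j u v. real (gdist (quotient_graph G (F j)) (comp (F j) u) (comp (F j) v))"
    have "(\<Sum>j = 1..k. weighted_wiener (quotient_graph G (F j)) (\<lambda>C. real (card (W \<inter> C)))) =
        1 / 2 * (\<Sum>j = 1..k. \<Sum>u\<in>W. \<Sum>v\<in>W. ?d j u v)"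
      by (simp add: weighted_wiener_quotient[OF fin W] sum_distrib_left)
    also have "(\<Sum>j = 1..k. \<Sum>u\<in>W. \<Sum>v\<in>W. ?d j u v) = (\<Sum>u\<in>W. \<Sum>v\<in>W. \<Sum>j = 1..k. ?d j u v)"
      by (subst sum.swap) (intro sum.cong refl sum.swap)
    also have "\<dots> = (\<Sum>u\<in>W. \<Sum>v\<in>W. real (gdist G u v))"
      using W gdist_eq_sum_quotients[OF assms(5)] assms(4)
      by (intro sum.cong refl) (auto simp: sum.reindex subset_iff)
    finally show ?thesis .
  qed
  show ?thesis
    unfolding graovac_pisanski_orbits[OF fin]
    by (subst sum.reindex_bij_betw[OF assms(3), symmetric])
      (intro arg_cong2[where f = "(*)"] sum.cong refl cut[symmetric] bij_betwE[OF assms(3), rule_format])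
qed

end
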